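(* Let $V$ be a finite set, let $S$ be a finite set of separations of $V$, and let $\tau$ be a tangle of $S$. Suppose $\tau$ has a guiding function $g : V \to \mathbb{R}_{\ge 0}$ with reliability $\rho := \min_{A \in \tau} \rho_A \in (\tfrac12, 1]$, where $\rho_A := \sum_{v \in A} g(v)$ for $A \in \tau$. Let $\eta := \frac{1}{\max_{v \in V} g(v)}$ and suppose further that $$\frac{\sum_{v \in V} g(v)\,(1 - g(v)\eta)}{4\eta} \cdot \sum_{A \in \tau_{\min}} \frac{1}{(\rho_A - \tfrac12)^2} < 1,$$ where $\tau_{\min} \subseteq \tau$ is the set of all minimal elements of $\tau$. Then $\tau$ has a guiding set $G \subseteq V$.
   Context: A separation of a finite set $V$ is a bipartition $\{A, A^c\}$ of $V$; its two sides are called oriented separations. For a set $S$ of separations, a tangle of $S$ is a set $\tau$ of oriented separations containing exactly one side of every separation in $S$ (and nothing else) such that $A_1 \cap A_2 \cap A_3 \neq \emptyset$ for all $A_1, A_2, A_3 \in \tau$ (not necessarily distinct). An element $A\in\tau$ is minimal if no $B \in \tau$ satisfies $B \subsetneq A$. A guiding function of $\tau$ is a function $g: V \to \mathbb{R}_{\ge 0}$ with $\sum_{v\in V} g(v) = 1$ whose reliability $\min_{A \in \tau} \sum_{v \in A} g(v)$ exceeds $\tfrac12$. A guiding set of $\tau$ is a nonempty set $G \subseteq V$ with $|G \cap A| > \tfrac12 |G|$ for every $A \in \tau$. *)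

theory Defs
  imports Complex_Main
begin

text \<open>A separation is the unordered pair of its two sides. As in a bipartition \<open>{A, A\<^sup>c}\<close> with
  arbitrary \<open>A \<subseteq> V\<close>, an empty side is allowed.\<close>
definition separation :: "'a set \<Rightarrow> 'a set set \<Rightarrow> bool" where
  "separation V s \<longleftrightarrow> (\<exists>A\<subseteq>V. s = {A, V - A})"

text \<open>The oriented separations arising from \<open>S\<close> are the elements of \<open>\<Union>S\<close>.\<close>
definition tangle :: "'a set set set \<Rightarrow> 'a set set \<Rightarrow> bool" where
  "tangle S \<tau> \<longleftrightarrow>
     \<tau> \<subseteq> \<Union>S \<and>
     (\<forall>s\<in>S. \<exists>!A. A \<in> s \<and> A \<in> \<tau>) \<and>
     (\<forall>A1\<in>\<tau>. \<forall>A2\<in>\<tau>. \<forall>A3\<in>\<tau>. A1 \<inter> A2 \<inter> A3 \<noteq> {})"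

definition minimal_elements :: "'a set set \<Rightarrow> 'a set set" where
  "minimal_elements \<tau> = {A \<in> \<tau>. \<not> (\<exists>B\<in>\<tau>. B \<subset> A)}"

text \<open>For the empty tangle (of \<open>S = {}\<close>) there is no minimum to take; the value is set to \<open>1\<close>,
  the largest possible reliability, so that this case is not left to the unspecified
  value of \<open>Min {}\<close>.\<close>
definition reliability :: "'a set set \<Rightarrow> ('a \<Rightarrow> real) \<Rightarrow> real" where
  "reliability \<tau> g = (if \<tau> = {} then 1 else Min ((\<lambda>A. \<Sum>v\<in>A. g v) ` \<tau>))"

text \<open>Only the values of \<open>g\<close> on \<open>V\<close> are constrained.\<close>
definition guiding_function :: "'a set \<Rightarrow> 'a set set \<Rightarrow> ('a \<Rightarrow> real) \<Rightarrow> bool" where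
  "guiding_function V \<tau> g \<longleftrightarrow>
     (\<forall>v\<in>V. 0 \<le> g v) \<and> (\<Sum>v\<in>V. g v) = 1 \<and> 1/2 < reliability \<tau> g"

definition guiding_set :: "'a set \<Rightarrow> 'a set set \<Rightarrow> 'a set \<Rightarrow> bool" where
  "guiding_set V \<tau> G \<longleftrightarrow>
     G \<noteq> {} \<and> G \<subseteq> V \<and> (\<forall>A\<in>\<tau>. real (card (G \<inter> A)) > 1/2 * real (card G))"

end

(* Choose G at random, putting each v into G independently with probability g v * \<eta>. For A in \<tau> the
   random variable card (G \<inter> A) - card (G - A) has mean 2 * \<eta> * (\<rho>A A - 1/2) and variance
   \<eta> * (\<Sum>v\<in>V. g v * (1 - g v * \<eta>)), so by Chebyshev's inequality and the union bound the hypothesis says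
   that with positive probability it is positive for every minimal A, hence for every A in \<tau>. The
   probability space is avoided by the method of conditional expectations: the elements of V are decided
   one by one so that the weighted sum of the squared deviations never exceeds its expected value. *)

theory Submission
  imports Defs
begin

text \<open>The right-hand side is the expected value of the left-hand side when every \<open>v \<in> V\<close> is put
  into \<open>G\<close> independently with probability \<open>p v\<close>.\<close>
lemma subset_weighted_deviation_le_expectation:
  fixes p :: "'a \<Rightarrow> real" and a t :: "'i \<Rightarrow> real" and c :: "'i \<Rightarrow> 'a \<Rightarrow> real"
  assumes "finite V" and "\<And>v. v \<in> V \<Longrightarrow> 0 \<le> p v \<and> p v \<le> 1"
  shows "\<exists>G\<subseteq>V. (\<Sum>i\<in>I. a i * ((\<Sum>v\<in>G. c i v) - t i)\<^sup>2)
    \<le> (\<Sum>i\<in>I. a i * ((\<Sum>v\<in>V. (c i v)\<^sup>2 * (p v * (1 - p v))) + ((\<Sum>v\<in>V. c i v * p v) - t i)\<^sup>2))"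
  using assms
proof (induction V arbitrary: t rule: finite_induct)
  case empty
  then show ?case by simp
next
  case (insert x V)
  \<comment> \<open>\<open>\<Phi> U s\<close> is the conditional expectation while the elements of
    \<open>U\<close> are still undecided. Putting \<open>x\<close> into \<open>G\<close> only shifts
    the target from \<open>t i\<close> to \<open>t i - c i x\<close>, hence the induction over
    arbitrary \<open>t\<close>.\<close>
  define \<Phi> where "\<Phi> U s =
    (\<Sum>i\<in>I. a i * ((\<Sum>v\<in>U. (c i v)\<^sup>2 * (p v * (1 - p v))) + ((\<Sum>v\<in>U. c i v * p v) - s i)\<^sup>2))"
    for U s
  have IH: "\<exists>G\<subseteq>V. (\<Sum>i\<in>I. a i * ((\<Sum>v\<in>G. c i v) - s i)\<^sup>2) \<le> \<Phi> V s" for s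
    unfolding \<Phi>_def by (rule insert.IH) (simp add: insert.prems)
  \<comment> \<open>Condition on whether \<open>x\<close> is chosen: averaging the two squared
    shifts also produces the variance \<open>(c i x)\<^sup>2 * (p x * (1 - p x))\<close> of
    \<open>x\<close>.\<close>
  have mean: "\<Phi> (insert x V) t = p x * \<Phi> V (\<lambda>i. t i - c i x) + (1 - p x) * \<Phi> V t"
  proof -
    have "a * ((k\<^sup>2 * (q * (1 - q)) + w) + ((k * q + m) - u)\<^sup>2)
        = q * (a * (w + (m - (u - k))\<^sup>2)) + (1 - q) * (a * (w + (m - u)\<^sup>2))"
      for a k q w m u :: real
      by algebra
    then show ?thesis
      unfolding \<Phi>_def sum_distrib_left sum.distrib[symmetric]
        sum.insert[OF insert.hyps] by (intro sum.cong refl)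
  qed
  have "\<Phi> V (\<lambda>i. t i - c i x) \<le> \<Phi> (insert x V) t \<or> \<Phi> V t \<le> \<Phi> (insert x V) t"
  proof (rule ccontr)
    assume "\<not> ?thesis"
    then have *: "\<Phi> (insert x V) t < min (\<Phi> V (\<lambda>i. t i - c i x)) (\<Phi> V t)"
      by simp
    have p: "0 \<le> p x" "0 \<le> 1 - p x"
      using insert.prems by auto
    \<comment> \<open>A convex combination is at least the minimum. \<open>convex_bound_le\<close>
      bounds from above, so it is applied to the negated values.\<close>
    have "min (\<Phi> V (\<lambda>i. t i - c i x)) (\<Phi> V t) \<le> \<Phi> (insert x V) t"
      unfolding mean using convex_bound_le[of "- \<Phi> V (\<lambda>i. t i - c i x)"
          "- min (\<Phi> V (\<lambda>i. t i - c i x)) (\<Phi> V t)" "- \<Phi> V t" "p x" "1 - p x"] p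
      by simp
    with * show False by linarith
  qed
  then show ?case
  proof
    assume le: "\<Phi> V (\<lambda>i. t i - c i x) \<le> \<Phi> (insert x V) t"
    obtain G where G: "G \<subseteq> V"
      "(\<Sum>i\<in>I. a i * ((\<Sum>v\<in>G. c i v) - (t i - c i x))\<^sup>2) \<le> \<Phi> V (\<lambda>i. t i - c i x)"
      using IH[of "\<lambda>i. t i - c i x"] by blast
    have "x \<notin> G" "finite G"
      using G(1) insert.hyps finite_subset by auto
    then have "(\<Sum>i\<in>I. a i * ((\<Sum>v\<in>insert x G. c i v) - t i)\<^sup>2) \<le> \<Phi> (insert x V) t"
      using G(2) le by (simp add: diff_diff_eq2 add.commute)
    then show ?thesis
      using G(1) unfolding \<Phi>_def by (intro exI[of _ "insert x G"]) auto
  next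
    assume le: "\<Phi> V t \<le> \<Phi> (insert x V) t"
    obtain G where "G \<subseteq> V" "(\<Sum>i\<in>I. a i * ((\<Sum>v\<in>G. c i v) - t i)\<^sup>2) \<le> \<Phi> V t"
      using IH[of t] by blast
    then show ?thesis
      using le unfolding \<Phi>_def by (intro exI[of _ G]) auto
  qed
qed

text \<open>Each summand of \<open>bound\<close> is a variance over a squared mean, Chebyshev's
  bound for a deviation as large as the mean. If the normalised squared deviations sum to less than
  1, each is below 1, so no sum drops to 0.\<close>

lemma chebyshev_union_bound_subset:
  fixes p :: "'a \<Rightarrow> real" and c :: "'i \<Rightarrow> 'a \<Rightarrow> real"
  assumes "finite V" and "finite I" and p: "\<And>v. v \<in> V \<Longrightarrow> 0 \<le> p v \<and> p v \<le> 1"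
    and mean_pos: "\<And>i. i \<in> I \<Longrightarrow> 0 < (\<Sum>v\<in>V. c i v * p v)"
    and bound: "(\<Sum>i\<in>I. (\<Sum>v\<in>V. (c i v)\<^sup>2 * (p v * (1 - p v))) / (\<Sum>v\<in>V. c i v * p v)\<^sup>2) < 1"
  shows "\<exists>G\<subseteq>V. \<forall>i\<in>I. 0 < (\<Sum>v\<in>G. c i v)"
proof -
  define m where "m i = (\<Sum>v\<in>V. c i v * p v)" for i
  \<comment> \<open>With target \<open>m i\<close> the bias term vanishes; the weights
    \<open>1 / (m i)\<^sup>2\<close> turn the right-hand side into the sum in
    \<open>bound\<close>.\<close>
  have "\<exists>G\<subseteq>V. (\<Sum>i\<in>I. 1 / (m i)\<^sup>2 * ((\<Sum>v\<in>G. c i v) - m i)\<^sup>2)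
    \<le> (\<Sum>i\<in>I. 1 / (m i)\<^sup>2 * ((\<Sum>v\<in>V. (c i v)\<^sup>2 * (p v * (1 - p v))) + ((\<Sum>v\<in>V. c i v * p v) - m i)\<^sup>2))"
    by (intro subset_weighted_deviation_le_expectation \<open>finite V\<close> p)
  then obtain G where "G \<subseteq> V"
    and lt1: "(\<Sum>i\<in>I. ((\<Sum>v\<in>G. c i v) - m i)\<^sup>2 / (m i)\<^sup>2) < 1"
    using bound by (auto simp: m_def)
  have "0 < (\<Sum>v\<in>G. c i v)" if "i \<in> I" for i
  proof -
    have "((\<Sum>v\<in>G. c i v) - m i)\<^sup>2 / (m i)\<^sup>2 \<le> (\<Sum>i\<in>I. ((\<Sum>v\<in>G. c i v) - m i)\<^sup>2 / (m i)\<^sup>2)"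
      using that \<open>finite I\<close> by (intro member_le_sum) auto
    with lt1 have "((\<Sum>v\<in>G. c i v) - m i)\<^sup>2 / (m i)\<^sup>2 < 1"
      by simp
    moreover have "0 < m i"
      using mean_pos[OF that] by (simp add: m_def)
    ultimately have "\<bar>(\<Sum>v\<in>G. c i v) - m i\<bar> < \<bar>m i\<bar>"
      by (intro power2_less_imp_less[of "\<bar>_\<bar>"]) (auto simp: field_simps)
    with \<open>0 < m i\<close> show ?thesis by linarith
  qed
  with \<open>G \<subseteq> V\<close> show ?thesis by blast
qed

text \<open>With signs, a strict majority of \<open>G\<close> in \<open>A\<close> becomes positivity
  of one sum, and the squares do not depend on \<open>A\<close>.\<close>

definition side_sign :: "'a set \<Rightarrow> 'a \<Rightarrow> real" where
  "side_sign A v = (if v \<in> A then 1 else -1)"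

lemma side_sign_power2 [simp]: "(side_sign A v)\<^sup>2 = 1"
  by (simp add: side_sign_def)

lemma sum_side_sign_mult:
  assumes "finite V" and "A \<subseteq> V"
  shows "(\<Sum>v\<in>V. side_sign A v * f v) = 2 * (\<Sum>v\<in>A. f v) - (\<Sum>v\<in>V. f v)"
proof -
  have "(\<Sum>v\<in>V. side_sign A v * f v)
      = (\<Sum>v\<in>V - A. side_sign A v * f v) + (\<Sum>v\<in>A. side_sign A v * f v)"
    using assms(2,1) by (rule sum.subset_diff)
  also have "\<dots> = - (\<Sum>v\<in>V - A. f v) + (\<Sum>v\<in>A. f v)"
    by (simp add: side_sign_def sum_negf)
  finally show ?thesis
    using sum.subset_diff[OF assms(2,1), of f] by simp
qed

lemma sum_side_sign:
  assumes "finite G"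
  shows "(\<Sum>v\<in>G. side_sign A v) = 2 * real (card (G \<inter> A)) - real (card G)"
proof -
  \<comment> \<open>\<open>A\<close> may stick out of \<open>G\<close>, so it is cut down to
    \<open>G \<inter> A\<close> first.\<close>
  have "(\<Sum>v\<in>G. side_sign A v) = (\<Sum>v\<in>G. side_sign (G \<inter> A) v * 1)"
    by (intro sum.cong) (auto simp: side_sign_def)
  also have "\<dots> = 2 * real (card (G \<inter> A)) - real (card G)"
    using assms by (subst sum_side_sign_mult) auto
  finally show ?thesis .
qed

lemma tangle_elements_subset:
  assumes "\<forall>s\<in>S. separation V s" and "tangle S \<tau>"
  shows "\<tau> \<subseteq> Pow V"
proof -
  have "\<tau> \<subseteq> \<Union>S"
    using assms(2) by (simp add: tangle_def)
  also have "\<Union>S \<subseteq> Pow V"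
    using assms(1) by (force simp: separation_def)
  finally show ?thesis .
qed

lemma guiding_function_half_less:
  assumes "finite \<tau>" and "guiding_function V \<tau> g" and "A \<in> \<tau>"
  shows "1/2 < (\<Sum>v\<in>A. g v)"
proof -
  have "Min ((\<lambda>A. \<Sum>v\<in>A. g v) ` \<tau>) \<le> (\<Sum>v\<in>A. g v)"
    using assms(1,3) by (intro Min_le) auto
  then show ?thesis
    using assms(2,3) by (auto simp: guiding_function_def reliability_def split: if_splits)
qed

theorem theorem4p3:
  fixes V :: "'a set" and S :: "'a set set set" and \<tau> :: "'a set set"
    and g :: "'a \<Rightarrow> real" and \<rho> \<eta> :: real and \<rho>A :: "'a set \<Rightarrow> real"
  assumes "finite V"
    and "finite S"
    and "\<forall>s\<in>S. separation V s"
    and "tangle S \<tau>"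
    and "guiding_function V \<tau> g"
    and "\<rho> = reliability \<tau> g"
    and "\<rho> \<in> {1/2<..1}"
    and "\<forall>A\<in>\<tau>. \<rho>A A = (\<Sum>v\<in>A. g v)"
    and "\<eta> = 1 / Max (g ` V)"
    and "(\<Sum>v\<in>V. g v * (1 - g v * \<eta>)) / (4 * \<eta>)
           * (\<Sum>A\<in>minimal_elements \<tau>. 1 / (\<rho>A A - 1/2)^2) < 1"
  shows "\<exists>G. guiding_set V \<tau> G"
proof -
  have g: "\<And>v. v \<in> V \<Longrightarrow> 0 \<le> g v" "(\<Sum>v\<in>V. g v) = 1"
    using assms(5) by (auto simp: guiding_function_def)
  have "V \<noteq> {}"
    using g(2) by auto
  have \<tau>: "\<tau> \<subseteq> Pow V" "finite \<tau>"
    using tangle_elements_subset[OF assms(3,4)] \<open>finite V\<close> by (auto intro: finite_subset)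
  have g_le_Max: "g v \<le> Max (g ` V)" if "v \<in> V" for v
    using that \<open>finite V\<close> by simp
  have "0 < Max (g ` V)"
  proof (rule ccontr)
    assume "\<not> ?thesis"
    then have "(\<Sum>v\<in>V. g v) \<le> 0"
      using g_le_Max by (intro sum_nonpos) force
    with g(2) show False by simp
  qed
  then have "0 < \<eta>"
    by (simp add: assms(9))
  \<comment> \<open>\<open>\<eta>\<close> is the largest factor that keeps all probabilities at most
    1; larger factors lower the ratio of variance to squared mean.\<close>
  define p where "p v = \<eta> * g v" for v
  have p: "0 \<le> p v \<and> p v \<le> 1" if "v \<in> V" for v
    using that g(1) g_le_Max \<open>0 < Max (g ` V)\<close> by (simp add: p_def assms(9))
  have mean: "(\<Sum>v\<in>V. side_sign A v * p v) = 2 * \<eta> * (\<rho>A A - 1/2)" if "A \<in> \<tau>" for A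
  proof -
    have "(\<Sum>v\<in>A. p v) = \<eta> * \<rho>A A" and "(\<Sum>v\<in>V. p v) = \<eta>"
      using that assms(8) g(2) by (simp_all add: p_def sum_distrib_left[symmetric])
    moreover have "A \<subseteq> V"
      using that \<tau>(1) by blast
    ultimately show ?thesis
      using sum_side_sign_mult[OF \<open>finite V\<close>, of A p] by (simp add: algebra_simps)
  qed
  have var: "(\<Sum>v\<in>V. p v * (1 - p v)) = \<eta> * (\<Sum>v\<in>V. g v * (1 - g v * \<eta>))"
    by (simp add: p_def sum_distrib_left mult_ac)
  have min_sub: "minimal_elements \<tau> \<subseteq> \<tau>"
    by (auto simp: minimal_elements_def)
  have ratio: "(\<Sum>v\<in>V. (side_sign A v)\<^sup>2 * (p v * (1 - p v))) / (\<Sum>v\<in>V. side_sign A v * p v)\<^sup>2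
      = (\<Sum>v\<in>V. g v * (1 - g v * \<eta>)) / (4 * \<eta>) * (1 / (\<rho>A A - 1/2)\<^sup>2)" if "A \<in> \<tau>" for A
  proof -
    have "\<eta> * x / (2 * \<eta> * y)\<^sup>2 = x / (4 * \<eta>) * (1 / y\<^sup>2)" for x y :: real
      using \<open>0 < \<eta>\<close> by (simp add: power2_eq_square)
    then show ?thesis
      by (simp only: side_sign_power2 mult_1 mean[OF that] var)
  qed
  have "\<exists>G\<subseteq>V. \<forall>A\<in>minimal_elements \<tau>. 0 < (\<Sum>v\<in>G. side_sign A v)"
  proof (rule chebyshev_union_bound_subset[where p = p])
    show "finite V" by fact
    show "0 \<le> p v \<and> p v \<le> 1" if "v \<in> V" for v
      using p[OF that] .
    show "finite (minimal_elements \<tau>)"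
      using min_sub \<tau>(2) by (rule finite_subset)
    show "0 < (\<Sum>v\<in>V. side_sign A v * p v)" if "A \<in> minimal_elements \<tau>" for A
    proof -
      have "A \<in> \<tau>" using that min_sub by blast
      then show ?thesis
        using guiding_function_half_less[OF \<tau>(2) assms(5)] assms(8) \<open>0 < \<eta>\<close> by (simp add: mean)
    qed
    have "(\<Sum>A\<in>minimal_elements \<tau>. (\<Sum>v\<in>V. (side_sign A v)\<^sup>2 * (p v * (1 - p v)))
          / (\<Sum>v\<in>V. side_sign A v * p v)\<^sup>2)
        = (\<Sum>A\<in>minimal_elements \<tau>.
            (\<Sum>v\<in>V. g v * (1 - g v * \<eta>)) / (4 * \<eta>) * (1 / (\<rho>A A - 1/2)\<^sup>2))"
      using min_sub by (intro sum.cong refl ratio) auto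
    then show "(\<Sum>A\<in>minimal_elements \<tau>. (\<Sum>v\<in>V. (side_sign A v)\<^sup>2 * (p v * (1 - p v)))
          / (\<Sum>v\<in>V. side_sign A v * p v)\<^sup>2) < 1"
      using assms(10) by (simp only: sum_distrib_left)
  qed
  then obtain G where "G \<subseteq> V"
    and G: "\<And>A. A \<in> minimal_elements \<tau> \<Longrightarrow> 0 < (\<Sum>v\<in>G. side_sign A v)"
    by blast
  have "finite G"
    using \<open>G \<subseteq> V\<close> \<open>finite V\<close> by (rule finite_subset)
  \<comment> \<open>As \<open>\<tau>\<close> is finite, \<open>A\<close> contains a minimal element,
    whose majority \<open>A\<close> inherits.\<close>
  have maj: "1/2 * real (card G) < real (card (G \<inter> A))" if A: "A \<in> \<tau>" for A
  proof -
    obtain B where B: "B \<in> \<tau>" "B \<subseteq> A" "\<forall>C\<in>\<tau>. C \<subseteq> B \<longrightarrow> B = C"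
      using finite_has_minimal2[OF \<tau>(2) A] by metis
    then have "B \<in> minimal_elements \<tau>"
      by (auto simp: minimal_elements_def)
    from G[OF this] have "1/2 * real (card G) < real (card (G \<inter> B))"
      by (simp add: sum_side_sign[OF \<open>finite G\<close>])
    also have "\<dots> \<le> real (card (G \<inter> A))"
      using \<open>finite G\<close> B(2) by (intro of_nat_mono card_mono) auto
    finally show ?thesis .
  qed
  show ?thesis
  \<comment> \<open>If \<open>\<tau>\<close> is empty, \<open>G\<close> might be empty, so
    \<open>V\<close> is taken instead. Otherwise the strict inequality in \<open>maj\<close>
    excludes an empty \<open>G\<close>.\<close>
  proof (cases "\<tau> = {}")
    case True
    with \<open>V \<noteq> {}\<close> show ?thesis
      by (auto simp: guiding_set_def)
  next
    case False
    then have "G \<noteq> {}"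
      using maj by fastforce
    with \<open>G \<subseteq> V\<close> maj show ?thesis
      by (auto simp: guiding_set_def)
  qed
qed

end
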